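(* For every $n\in\mathbb{N}$ the following relations hold in $U$: $$[x(yyxx)^ny,y]=(q^2-q^{-2})xyy(xxyy)^n,$$ $$[y,y(xxyy)^nx]=(q^2-q^{-2})(yyxx)^nyyx,$$ $$[xyy(xxyy)^nx,y]=0,$$ $$[yxx(yyxx)^ny,y]=(q^2-q^{-2})\left(y(xxyy)^{n+1}-(yyxx)^{n+1}y\right).$$
   Context: Let $\mathbb{F}$ be a field of characteristic zero and let $q\in\mathbb{F}$ be nonzero and not a root of unity; $\mathbb{N}=\{0,1,2,\ldots\}$. Let $\mathbb{V}$ be the free associative unital $\mathbb{F}$-algebra on two noncommuting generators (letters) $x,y$; the words in $x,y$ (including the trivial word $\mathbf{1}$) form a basis of $\mathbb{V}$. Words such as $(xxyy)^nx$ are written with respect to the free (concatenation) product. The $q$-shuffle product $\star$ on the vector space $\mathbb{V}$ is the bilinear associative product with unit $\mathbf{1}$ determined as follows. Put $\langle x,x\rangle=\langle y,y\rangle=2$ and $\langle x,y\rangle=\langle y,x\rangle=-2$. For nontrivial words $u=u_1\cdots u_r$ and $v=v_1\cdots v_s$, $$u\star v=u_1\big((u_2\cdots u_r)\star v\big)+v_1\big(u\star(v_2\cdots v_s)\big)q^{\langle v_1,u_1\rangle+\cdots+\langle v_1,u_r\rangle}.$$ $U$ denotes the subalgebra of $(\mathbb{V},\star)$ generated by $x,y$; all the words in the statement lie in $U$. The commutator is taken with respect to $\star$: $[X,Y]=X\star Y-Y\star X$. *)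

theory Defs
  imports "HOL-Library.Poly_Mapping" "HOL.Hull"
begin

datatype letter = X | Y

instantiation list :: (type) monoid_add
begin

definition zero_list :: "'a list" where "zero_list = []"

definition plus_list :: "'a list \<Rightarrow> 'a list \<Rightarrow> 'a list" where "plus_list u v = u @ v"

instance by standard (simp_all add: zero_list_def plus_list_def)

end

text \<open>
  The free algebra is the monoid algebra of the free monoid of words: with the instance above,
  the product \<open>*\<close> of \<^typ>\<open>letter list \<Rightarrow>\<^sub>0 'a\<close> is the free (concatenation) product, its unit
  \<open>1\<close> is the trivial word, and \<open>^\<close> is the power with respect to the free product.
\<close>

type_synonym 'a free_alg = "letter list \<Rightarrow>\<^sub>0 'a"

definition word :: "letter list \<Rightarrow> 'a::field free_alg"
  where "word w = Poly_Mapping.single w 1"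

definition smult :: "'a::field \<Rightarrow> 'a free_alg \<Rightarrow> 'a free_alg"
  where "smult c f = Poly_Mapping.map ((*) c) f"

abbreviation gen_x :: "'a::field free_alg" ("\<^bold>x") where "\<^bold>x \<equiv> word [X]"
abbreviation gen_y :: "'a::field free_alg" ("\<^bold>y") where "\<^bold>y \<equiv> word [Y]"

definition letter_form :: "letter \<Rightarrow> letter \<Rightarrow> int"
  where "letter_form a b = (if a = b then 2 else -2)"

fun qshuffle_words :: "'a::field \<Rightarrow> letter list \<Rightarrow> letter list \<Rightarrow> 'a free_alg" where
  "qshuffle_words q [] v = word v"
| "qshuffle_words q u [] = word u"
| "qshuffle_words q (a # u) (b # v) =
     word [a] * qshuffle_words q u (b # v) +
     smult (q powi (\<Sum>c\<leftarrow>a # u. letter_form b c)) (word [b] * qshuffle_words q (a # u) v)"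

definition qshuffle :: "'a::field \<Rightarrow> 'a free_alg \<Rightarrow> 'a free_alg \<Rightarrow> 'a free_alg"
  where "qshuffle q f g =
    (\<Sum>u\<in>Poly_Mapping.keys f. \<Sum>v\<in>Poly_Mapping.keys g.
       smult (Poly_Mapping.lookup f u * Poly_Mapping.lookup g v) (qshuffle_words q u v))"

definition qcomm :: "'a::field \<Rightarrow> 'a free_alg \<Rightarrow> 'a free_alg \<Rightarrow> 'a free_alg"
  where "qcomm q f g = qshuffle q f g - qshuffle q g f"

definition qshuffle_subalgebra :: "'a::field \<Rightarrow> 'a free_alg set \<Rightarrow> bool"
  where "qshuffle_subalgebra q S \<longleftrightarrow>
    1 \<in> S \<and> (\<forall>f\<in>S. \<forall>g\<in>S. f + g \<in> S \<and> qshuffle q f g \<in> S) \<and> (\<forall>c. \<forall>f\<in>S. smult c f \<in> S)"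

definition U :: "'a::field \<Rightarrow> 'a free_alg set"
  where "U q = (qshuffle_subalgebra q) hull {\<^bold>x, \<^bold>y}"

end

theory Submission
  imports Defs Complex_Main
begin

text \<open>
  Shuffling a letter \<open>c\<close> into a word inserts \<open>c\<close> at every position, with a power of \<open>q\<close>
  given by the preceding prefix. Inserting into a block \<open>cc\<close> gives the same word three times; in a
  suitable \<open>q\<close>-commutator these weights cancel, and the one inside a block \<open>dd\<close> vanishes, so
  for a doubly alternating word only the boundary insertions survive. This gives the four relations,
  and also leads inside \<open>U\<close> from \<open>(ccdd)\<^sup>n\<close> through \<open>(ccdd)\<^sup>nc\<close>, \<open>d(ccdd)\<^sup>nc\<close> and
  \<open>dcc(ddcc)\<^sup>n\<close> to the difference of \<open>(ddcc)\<^bsup>n+1\<^esup>\<close> and the palindrome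
  \<open>(dccd)\<^bsup>n+1\<^esup>\<close>. A word of length \<open>N\<close> equals a multiple of its reversal modulo products of
  its suffixes with its reversed prefixes; for a balanced palindrome of even length this puts
  \<open>1 + q\<^bsup>-N\<^esup> \<noteq> 0\<close> times the word into \<open>U\<close>, which closes the induction.
\<close>

section \<open>Scalars and words in the free algebra\<close>

lemma lookup_smult: "Poly_Mapping.lookup (smult c f) w = c * Poly_Mapping.lookup f w"
  by (simp add: smult_def map.rep_eq when_def)

interpretation free_alg: vector_space smult
  by unfold_locales (rule poly_mapping_eqI; simp add: lookup_smult lookup_add algebra_simps)+

text \<open>The scalar stands on the right so that \<open>times_smult\<close> needs only
  associativity.\<close>

lemma smult_eq_times_single: "smult c f = f * Poly_Mapping.single 0 c"
proof (rule poly_mapping_eqI)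
  fix w
  have "(\<Sum>r. Poly_Mapping.lookup (Poly_Mapping.single (0 :: letter list) c) r when w = l + r)
      = (c when w = l)" for l
    by (subst Sum_any.expand_superset[of "{0}"]) (auto simp: lookup_single when_def)
  then have "Poly_Mapping.lookup (f * Poly_Mapping.single 0 c) w
      = (\<Sum>l. c * Poly_Mapping.lookup f l when w = l)"
    unfolding times_poly_mapping.rep_eq prod_fun_def
    by (intro Sum_any.cong) (simp add: when_def)
  also have "\<dots> = c * Poly_Mapping.lookup f w"
    by simp
  finally show "Poly_Mapping.lookup (smult c f) w
      = Poly_Mapping.lookup (f * Poly_Mapping.single 0 c) w"
    by (simp add: lookup_smult)
qed

lemma times_smult: "f * smult c g = smult c (f * g)"
  by (metis mult.assoc smult_eq_times_single)

lemma word_mult: "word u * word v = word (u @ v)"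
  by (simp add: word_def mult_single plus_list_def)

lemma word_Nil: "word [] = 1"
  by (simp add: word_def zero_list_def flip: single_one)

lemma word_power: "word u ^ n = word (concat (replicate n u))"
  by (induction n) (simp_all add: word_Nil word_mult)

lemma qshuffle_word: "qshuffle q (word u) (word v) = qshuffle_words q u v"
  by (simp add: qshuffle_def word_def)

lemma concat_replicate_rotate:
  "concat (replicate n (u @ v)) @ u = u @ concat (replicate n (v @ u))"
  by (induction n) simp_all

lemma qshuffle_words_Nil_right [simp]: "qshuffle_words q u [] = word u"
  by (cases u) simp_all

lemma letter_form_same [simp]: "letter_form a a = 2"
  by (simp add: letter_form_def)

lemma letter_form_distinct [simp]: "a \<noteq> b \<Longrightarrow> letter_form a b = -2"
  by (simp add: letter_form_def)

lemma letter_form_sym: "letter_form a b = letter_form b a"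
  by (simp add: letter_form_def)

section \<open>Products with a single letter\<close>

abbreviation form_word :: "letter \<Rightarrow> letter list \<Rightarrow> int"
  where "form_word c w \<equiv> (\<Sum>b\<leftarrow>w. letter_form c b)"

text \<open>Inserting \<open>c\<close> into \<open>w\<close> after the prefix \<open>p\<close> is weighted by \<open>f\<close> at
  \<open>k + \<langle>c, p\<rangle>\<close>; products with \<open>c\<close> on either side, hence all their linear combinations,
  have this shape.\<close>

primrec insertions :: "(int \<Rightarrow> 'a::field) \<Rightarrow> letter \<Rightarrow> int \<Rightarrow> letter list \<Rightarrow> 'a free_alg" where
  "insertions f c k [] = smult (f k) (word [c])"
| "insertions f c k (b # w) = smult (f k) (word (c # b # w)) +
     word [b] * insertions f c (k + letter_form c b) w"

lemma insertions_linear: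
  "insertions (\<lambda>j. \<alpha> * f j + \<beta> * g j) c k w
    = smult \<alpha> (insertions f c k w) + smult \<beta> (insertions g c k w)"
  by (induction w arbitrary: k)
    (simp_all add: free_alg.scale_left_distrib free_alg.scale_right_distrib distrib_left times_smult
      add_ac)

lemma qshuffle_words_letter_left:
  assumes "q \<noteq> 0"
  shows "insertions ((powi) q) c k w = smult (q powi k) (qshuffle_words q [c] w)"
  by (induction w arbitrary: k)
    (simp_all add: assms free_alg.scale_right_distrib times_smult word_mult power_int_add
      letter_form_sym)

text \<open>From the right, \<open>c\<close> is weighted by its pairing with the suffix: the total
  \<open>form_word c w\<close> minus the pairing with the prefix.\<close>

lemma qshuffle_words_letter_right:
  assumes "q \<noteq> 0"
  shows "insertions (\<lambda>j. q powi (m - j)) c k w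
    = smult (q powi (m - k - form_word c w)) (qshuffle_words q w [c])"
proof (induction w arbitrary: k)
  case (Cons b w)
  have "q powi (m - k) = q powi (m - k - form_word c (b # w)) * q powi (form_word c (b # w))"
    using assms by (simp flip: power_int_add)
  then show ?case
    by (simp add: Cons free_alg.scale_right_distrib times_smult word_mult diff_diff_eq add_ac)
qed simp

lemma letter_combination:
  assumes "q \<noteq> 0"
  shows "smult \<alpha> (qshuffle q (word [c]) (word w)) + smult \<beta> (qshuffle q (word w) (word [c]))
    = insertions (\<lambda>j. \<alpha> * q powi j + \<beta> * q powi (form_word c w - j)) c 0 w"
  using qshuffle_words_letter_left[OF assms, of c 0 w]
    qshuffle_words_letter_right[OF assms, of "form_word c w" c 0 w]
  by (simp add: insertions_linear qshuffle_word)

text \<open>Zero total pairing makes the suffix weight inverse to the prefix weight, so the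
  commutator weight is odd and vanishes at 0.\<close>

lemma qcomm_letter_right:
  assumes "q \<noteq> 0" "form_word c w = 0"
  shows "qcomm q (word w) (word [c]) = insertions (\<lambda>j. q powi (- j) - q powi j) c 0 w"
  using letter_combination[OF assms(1), of "-1" c w 1] assms(2)
  by (simp add: qcomm_def algebra_simps)

lemma qcomm_minus: "qcomm q f g = - qcomm q g f"
  by (simp add: qcomm_def)

section \<open>Insertions into doubly alternating words\<close>

abbreviation blocks :: "letter \<Rightarrow> letter \<Rightarrow> nat \<Rightarrow> letter list"
  where "blocks a b n \<equiv> concat (replicate n [a, a, b, b])"

lemma form_word_blocks [simp]: "a \<noteq> b \<Longrightarrow> form_word c (blocks a b n) = 0"
  by (induction n) (auto simp: letter_form_def, (metis letter.exhaust)+)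

text \<open>The three positions around \<open>cc\<close> yield \<open>ccc\<close> with weights
  \<open>f k\<close>, 0, \<open>- f k\<close>; inside \<open>dd\<close> the level is
  \<open>k + 2\<close> again, of weight 0.\<close>

lemma insertions_blocks_same:
  assumes "c \<noteq> d" "f (k + 2) = 0" "f (k + 4) = - f k"
  shows "insertions f c k (blocks c d n @ w) = word (blocks c d n) * insertions f c k w"
proof (induction n)
  case (Suc n)
  have "f (2 + k) = 0" "f (4 + k) = - f k"
    using assms by (simp_all add: add.commute)
  then have "insertions f c k (blocks c d (Suc n) @ w)
      = word [c, c, d, d] * insertions f c k (blocks c d n @ w)"
    using assms
    by (simp add: distrib_left times_smult word_mult right_diff_distrib flip: mult.assoc)
  then show ?case
    unfolding Suc.IH by (simp add: word_mult flip: mult.assoc)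
qed (simp add: word_Nil)

text \<open>Positions inside \<open>dd\<close> and \<open>cc\<close> have level \<open>k - 2\<close>
  and weight 0; the insertions before and after \<open>cc\<close> cancel. The subtracted word does
  this for the last block and the front of \<open>w\<close>.\<close>

lemma insertions_blocks_other:
  assumes "c \<noteq> d" "f (k - 2) = 0" "f (k - 4) = - f k"
  shows "insertions f c k (blocks d c n @ w) =
    smult (f k) (word (c # blocks d c n @ w) - word (blocks d c n @ c # w))
    + word (blocks d c n) * insertions f c k w"
proof (induction n)
  case (Suc n)
  have "insertions f c k (blocks d c (Suc n) @ w) =
      smult (f k) (word (c # blocks d c (Suc n) @ w) - word ([d, d, c, c, c] @ blocks d c n @ w))
      + word [d, d, c, c] * insertions f c k (blocks d c n @ w)"
    using assms
    by (simp add: distrib_left right_diff_distrib times_smult word_mult free_alg.scale_right_diff_distrib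
        flip: mult.assoc)
  then show ?case
    unfolding Suc.IH
    by (simp add: distrib_left times_smult word_mult right_diff_distrib
        free_alg.scale_right_diff_distrib flip: mult.assoc)
qed (simp add: word_Nil)

section \<open>The commutators\<close>

lemma qcomm_Cons_blocks_snoc_right:
  assumes "q \<noteq> 0" "c \<noteq> d"
  shows "qcomm q (word (d # blocks c d n @ [c])) (word [c])
    = smult (q powi 2 - q powi (-2)) (word (d # c # c # blocks d c n))"
proof -
  have *: "d # c # c # blocks d c n = d # blocks c d n @ [c, c]"
    using concat_replicate_rotate[of n "[c, c]" "[d, d]"] by simp
  \<comment> \<open>Level 0 before \<open>d\<close> has weight 0; behind it the level is -2, where
    oddness gives the conditions for the blocks to cancel.\<close>
  have "qcomm q (word (d # blocks c d n @ [c])) (word [c])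
      = word [d] * insertions (\<lambda>j. q powi (- j) - q powi j) c (- 2) (blocks c d n @ [c])"
    using assms by (subst qcomm_letter_right) simp_all
  also have "\<dots> = smult (q powi 2 - q powi (-2)) (word (d # blocks c d n @ [c, c]))"
    using assms by (subst insertions_blocks_same) (simp_all add: times_smult word_mult)
  finally show ?thesis
    unfolding * .
qed

text \<open>Past the leading \<open>c\<close> the level is 2, and after telescoping only the
  insertion directly behind it survives.\<close>

lemma qcomm_Cons_blocks_snoc_left:
  assumes "q \<noteq> 0" "c \<noteq> d"
  shows "qcomm q (word [c]) (word (c # blocks d c n @ [d]))
    = smult (q powi 2 - q powi (-2)) (word (blocks c d n @ [c, c, d]))"
proof -
  have *: "blocks c d n @ [c, c, d] = c # c # blocks d c n @ [d]"
    using arg_cong[OF concat_replicate_rotate[of n "[c, c]" "[d, d]"], of "\<lambda>w. w @ [d]"] by simp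
  have "qcomm q (word [c]) (word (c # blocks d c n @ [d]))
      = - (word [c] * insertions (\<lambda>j. q powi (- j) - q powi j) c 2 (blocks d c n @ [d]))"
    using assms by (subst qcomm_minus, subst qcomm_letter_right) simp_all
  also have "\<dots> = smult (q powi 2 - q powi (-2)) (word (c # c # blocks d c n @ [d]))"
    using assms by (subst insertions_blocks_other)
      (simp_all add: times_smult word_mult distrib_left right_diff_distrib
        free_alg.scale_right_diff_distrib free_alg.scale_left_diff_distrib)
  finally show ?thesis
    unfolding * .
qed

text \<open>Regrouped behind the first \<open>d\<close>, every \<open>c\<close> lies in a complete
  \<open>cc\<close>; both ends of the word have level 0.\<close>

lemma qcomm_palindrome_outer_other:
  assumes "q \<noteq> 0" "c \<noteq> d"
  shows "qcomm q (word (d # c # c # blocks d c n @ [d])) (word [c]) = 0"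
proof -
  have *: "d # c # c # blocks d c n @ [d] = d # blocks c d n @ [c, c, d]"
    using concat_replicate_rotate[of n "[c, c]" "[d, d]"] by simp
  have "qcomm q (word (d # blocks c d n @ [c, c, d])) (word [c])
      = word [d] * insertions (\<lambda>j. q powi (- j) - q powi j) c (- 2) (blocks c d n @ [c, c, d])"
    using assms by (subst qcomm_letter_right) simp_all
  also have "\<dots> = 0"
    using assms by (subst insertions_blocks_same)
      (simp_all add: times_smult word_mult distrib_left right_diff_distrib
        free_alg.scale_left_diff_distrib)
  finally show ?thesis
    unfolding * .
qed

text \<open>Each outer \<open>c\<close> stands alone: its outer side has weight 0, and the inner
  sides, at levels 2 and -2, contribute with opposite weights.\<close>

lemma qcomm_palindrome_outer_same:
  assumes "q \<noteq> 0" "c \<noteq> d"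
  shows "qcomm q (word (c # d # d # blocks c d n @ [c])) (word [c])
    = smult (q powi 2 - q powi (-2))
        (word (c # blocks d c (Suc n)) - word (blocks c d (Suc n) @ [c]))"
proof -
  have rot: "blocks d c n @ [d, d] = d # d # blocks c d n"
    using concat_replicate_rotate[of n "[d, d]" "[c, c]"] by simp
  have *: "c # d # d # blocks c d n @ [c] = c # blocks d c n @ [d, d, c]"
    using rot by simp
  have **: "blocks d c (Suc n) = blocks d c n @ [d, d, c, c]"
    using concat_replicate_rotate[of n "[d, d, c, c]" "[]"] by simp
  have "qcomm q (word (c # blocks d c n @ [d, d, c])) (word [c])
      = word [c] * insertions (\<lambda>j. q powi (- j) - q powi j) c 2 (blocks d c n @ [d, d, c])"
    using assms by (subst qcomm_letter_right) simp_all
  also have "\<dots> = smult (q powi 2 - q powi (-2))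
        (word (c # blocks d c n @ [d, d, c, c]) - word (c # c # blocks d c n @ [d, d, c]))"
    using assms by (subst insertions_blocks_other)
      (simp_all add: times_smult word_mult distrib_left right_diff_distrib
        free_alg.scale_right_diff_distrib free_alg.scale_left_diff_distrib)
  also have "c # c # blocks d c n @ [d, d, c] = blocks c d (Suc n) @ [c]"
    using rot by simp
  finally show ?thesis
    unfolding * ** .
qed

section \<open>Membership in the subalgebra\<close>

lemma qshuffle_subalgebra_U: "qshuffle_subalgebra q (U q)"
  unfolding U_def by (rule hull_in) (simp add: qshuffle_subalgebra_def)

lemma U_add: "f \<in> U q \<Longrightarrow> g \<in> U q \<Longrightarrow> f + g \<in> U q"
  using qshuffle_subalgebra_U[of q] by (simp add: qshuffle_subalgebra_def)

lemma U_qshuffle: "f \<in> U q \<Longrightarrow> g \<in> U q \<Longrightarrow> qshuffle q f g \<in> U q"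
  using qshuffle_subalgebra_U[of q] by (simp add: qshuffle_subalgebra_def)

lemma U_smult: "f \<in> U q \<Longrightarrow> smult c f \<in> U q"
  using qshuffle_subalgebra_U[of q] by (simp add: qshuffle_subalgebra_def)

lemma U_word_Nil: "word [] \<in> U q"
  using qshuffle_subalgebra_U[of q] by (simp add: qshuffle_subalgebra_def word_Nil)

lemma U_diff: "f \<in> U q \<Longrightarrow> g \<in> U q \<Longrightarrow> f - g \<in> U q"
  using U_add[of f q "smult (-1) g"] U_smult[of g q "-1"] by simp

lemma U_qcomm: "f \<in> U q \<Longrightarrow> g \<in> U q \<Longrightarrow> qcomm q f g \<in> U q"
  by (simp add: qcomm_def U_diff U_qshuffle)

lemma U_letter: "word [c] \<in> U q"
  using hull_subset[of "{\<^bold>x, \<^bold>y}" "qshuffle_subalgebra q"]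
  by (cases c) (simp_all add: U_def)

lemma U_smult_iff: "c \<noteq> 0 \<Longrightarrow> smult c f \<in> U q \<longleftrightarrow> f \<in> U q"
  using U_smult[of "smult c f" q "inverse c"] U_smult[of f q c] by auto

text \<open>Odd about its zero at level \<open>- m\<close>; \<open>m\<close> is chosen to place that
  level inside the blocks.\<close>

abbreviation odd_weight :: "'a::field \<Rightarrow> int \<Rightarrow> int \<Rightarrow> 'a"
  where "odd_weight q m k \<equiv> q powi (k + m) - q powi (- k - m)"

text \<open>The weight combines prefix and suffix weights, so the sum combines the two products of
  \<open>w\<close> with \<open>c\<close>.\<close>

lemma U_insertions:
  assumes "q \<noteq> 0" "word w \<in> U q"
  shows "insertions (odd_weight q m) c 0 w \<in> U q"
proof -
  have eq: "odd_weight q m = (\<lambda>j. q powi m * q powi j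
      + (- (q powi (- m - form_word c w))) * q powi (form_word c w - j))"
  proof
    fix j
    have "- j - m = (- m - form_word c w) + (form_word c w - j)"
      by simp
    then have "q powi (- j - m) = q powi (- m - form_word c w) * q powi (form_word c w - j)"
      using assms(1) power_int_add by metis
    then show "odd_weight q m j = q powi m * q powi j
      + (- (q powi (- m - form_word c w))) * q powi (form_word c w - j)"
      using assms(1) by (simp add: power_int_add)
  qed
  show ?thesis
    unfolding eq
      letter_combination[OF assms(1), of "q powi m" c w "- (q powi (- m - form_word c w))", symmetric]
    by (intro U_add U_smult U_qshuffle U_letter assms(2))
qed

lemma odd_weight_2:
  fixes q :: "'a::field"
  assumes "q \<noteq> 0" "q ^ 4 \<noteq> 1"
  shows "q powi 2 - q powi (- 2) \<noteq> 0" "q powi (- 2) - q powi 2 \<noteq> 0"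
  using assms by (auto simp: power_int_minus field_simps simp flip: power_add)

text \<open>Shift -2 puts the zero at level 2, inside each \<open>cc\<close> and \<open>dd\<close>;
  only the insertion at the end survives.\<close>

lemma U_blocks_snoc:
  assumes "q \<noteq> 0" "q ^ 4 \<noteq> 1" "c \<noteq> d" "word (blocks c d n) \<in> U q"
  shows "word (blocks c d n @ [c]) \<in> U q"
proof -
  have "insertions (odd_weight q (- 2)) c 0 (blocks c d n @ [])
      = smult (q powi (- 2) - q powi 2) (word (blocks c d n @ [c]))"
    using assms by (subst insertions_blocks_same) (simp_all add: times_smult word_mult)
  then show ?thesis
    using U_insertions[OF assms(1,4), of "- 2" c] odd_weight_2[OF assms(1,2)]
    by (simp add: U_smult_iff)
qed

text \<open>Shift 2 puts the zero at level -2; telescoping leaves only the insertion at the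
  front.\<close>

lemma U_Cons_blocks:
  assumes "q \<noteq> 0" "q ^ 4 \<noteq> 1" "c \<noteq> d" "word (blocks d c n) \<in> U q"
  shows "word (c # blocks d c n) \<in> U q"
proof -
  have "insertions (odd_weight q 2) c 0 (blocks d c n @ [])
      = smult (q powi 2 - q powi (- 2)) (word (c # blocks d c n))"
    using assms by (subst insertions_blocks_other)
      (simp_all add: times_smult word_mult free_alg.scale_right_diff_distrib)
  then show ?thesis
    using U_insertions[OF assms(1,4), of 2 c] odd_weight_2[OF assms(1,2)]
    by (simp add: U_smult_iff)
qed

lemma U_Cons_blocks_snoc:
  assumes "q \<noteq> 0" "q ^ 4 \<noteq> 1" "c \<noteq> d" "word (blocks d c n @ [d]) \<in> U q"
  shows "word (c # blocks d c n @ [d]) \<in> U q"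
proof -
  have "insertions (odd_weight q 2) c 0 (blocks d c n @ [d])
      = smult (q powi 2 - q powi (- 2)) (word (c # blocks d c n @ [d]))"
    using assms by (subst insertions_blocks_other)
      (simp_all add: times_smult word_mult free_alg.scale_right_diff_distrib)
  then show ?thesis
    using U_insertions[OF assms(1,4), of 2 c] odd_weight_2[OF assms(1,2)]
    by (simp add: U_smult_iff)
qed

lemma U_Cons3_blocks:
  assumes "q \<noteq> 0" "q ^ 4 \<noteq> 1" "c \<noteq> d" "word (d # blocks c d n @ [c]) \<in> U q"
  shows "word (d # c # c # blocks d c n) \<in> U q"
  using U_qcomm[OF assms(4) U_letter, of c] odd_weight_2[OF assms(1,2)]
  unfolding qcomm_Cons_blocks_snoc_right[OF assms(1,3)] by (simp add: U_smult_iff)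

lemma U_blocks_append3:
  assumes "q \<noteq> 0" "q ^ 4 \<noteq> 1" "c \<noteq> d" "word (c # blocks d c n @ [d]) \<in> U q"
  shows "word (blocks c d n @ [c, c, d]) \<in> U q"
  using U_qcomm[OF U_letter assms(4), of c] odd_weight_2[OF assms(1,2)]
  unfolding qcomm_Cons_blocks_snoc_left[OF assms(1,3)] by (simp add: U_smult_iff)

text \<open>With shift 0 the surviving insertions are behind the first letter and at the very end,
  at levels 2 and -2 with opposite weights.\<close>

lemma U_blocks_diff_palindrome:
  assumes "q \<noteq> 0" "q ^ 4 \<noteq> 1" "c \<noteq> d" "word (c # d # d # blocks c d n) \<in> U q"
  shows "word (blocks c d (Suc n)) - word (concat (replicate (Suc n) [c, d, d, c])) \<in> U q"
proof -
  have rot: "blocks d c n @ [d, d] = d # d # blocks c d n"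
    using concat_replicate_rotate[of n "[d, d]" "[c, c]"] by simp
  have *: "blocks d c n @ d # d # w = d # d # blocks c d n @ w" for w
    using arg_cong[OF rot, of "\<lambda>v. v @ w"] by simp
  have pal: "d # d # blocks c d n @ [c] = d # d # c # concat (replicate n [c, d, d, c])"
    using concat_replicate_rotate[of n "[c]" "[c, d, d]"] by simp
  have "insertions (odd_weight q 0) c 0 (c # blocks d c n @ [d, d])
      = word [c] * insertions (odd_weight q 0) c 2 (blocks d c n @ [d, d])"
    by simp
  also have "\<dots> = smult (q powi 2 - q powi (- 2))
      (word (c # c # blocks d c n @ [d, d]) - word (c # blocks d c n @ [d, d, c]))"
    using assms by (subst insertions_blocks_other)
      (simp_all add: times_smult word_mult distrib_left right_diff_distrib
        free_alg.scale_right_diff_distrib free_alg.scale_left_diff_distrib)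
  also have "\<dots> = smult (q powi 2 - q powi (- 2))
      (word (blocks c d (Suc n)) - word (concat (replicate (Suc n) [c, d, d, c])))"
    using pal by (simp add: *)
  finally have eq: "insertions (odd_weight q 0) c 0 (c # blocks d c n @ [d, d])
    = smult (q powi 2 - q powi (- 2))
      (word (blocks c d (Suc n)) - word (concat (replicate (Suc n) [c, d, d, c])))" .
  have "word (c # blocks d c n @ [d, d]) \<in> U q"
    using assms(4) by (simp add: rot)
  from U_insertions[OF assms(1) this, of 0 c] show ?thesis
    unfolding eq by (rule iffD1[OF U_smult_iff[OF odd_weight_2(1)[OF assms(1,2)]]])
qed

section \<open>Palindromes\<close>

text \<open>The exponent collected while \<open>v\<close> moves across: each letter pairs with
  \<open>p\<close> and all earlier letters of \<open>v\<close>.\<close>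

primrec pair_form :: "letter list \<Rightarrow> letter list \<Rightarrow> int" where
  "pair_form p [] = 0"
| "pair_form p (a # v) = form_word a p + pair_form (a # p) v"

text \<open>Modulo \<open>U\<close>, the recursion for \<open>rev s \<star> t\<close> moves one letter of \<open>w = s @ t\<close> at a
  time across the product, up to a sign and a power of \<open>q\<close>; going from \<open>s = []\<close> to
  \<open>t = []\<close> compares \<open>w\<close> with its reversal.\<close>

lemma U_reverse_step:
  assumes "q \<noteq> 0"
    and "\<And>s t. v = s @ t \<Longrightarrow> t \<noteq> [] \<Longrightarrow> word (rev s @ b # p) \<in> U q \<and> word t \<in> U q"
  shows "word [b] * qshuffle_words q p v
    - smult ((- 1) ^ length v * q powi pair_form (b # p) v) (word (rev v @ b # p)) \<in> U q"
  using assms(2)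
proof (induction v arbitrary: b p)
  case Nil
  show ?case
    \<comment> \<open>Both terms are \<open>word (b # p)\<close>; the scalar 0 supplies 0 in
      \<open>U\<close>.\<close>
    using U_smult[OF U_letter, of 0] by (simp add: word_mult)
next
  case (Cons a v)
  define e where "e = q powi form_word a (b # p)"
  define g where "g = smult ((- 1) ^ length v * q powi pair_form (a # b # p) v)
    (word (rev v @ a # b # p))"
  have "word (rev s @ a # b # p) \<in> U q \<and> word t \<in> U q" if "v = s @ t" "t \<noteq> []" for s t
    using Cons.prems[of "a # s" t] that by simp
  then have IH: "word [a] * qshuffle_words q (b # p) v - g \<in> U q"
    unfolding g_def by (rule Cons.IH)
  \<comment> \<open>This product is the current term plus \<open>e\<close> times the term of the
    induction hypothesis, whence the alternating sign.\<close>
  have "qshuffle q (word (b # p)) (word (a # v)) \<in> U q"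
    using Cons.prems[of "[]" "a # v"] by (auto intro: U_qshuffle)
  then have "word [b] * qshuffle_words q p (a # v)
      + smult e (word [a] * qshuffle_words q (b # p) v) \<in> U q"
    by (simp add: qshuffle_word e_def)
  from U_diff[OF this U_smult[OF IH, of e]]
  have "word [b] * qshuffle_words q p (a # v) + smult e g \<in> U q"
    by (simp add: free_alg.scale_right_diff_distrib)
  then show ?case
    using assms(1) by (simp add: g_def e_def power_int_add mult_ac)
qed

abbreviation balance :: "letter list \<Rightarrow> int"
  where "balance w \<equiv> (\<Sum>a\<leftarrow>w. if a = X then 1 else - 1)"

text \<open>The form has rank one: twice the product of the signs of the two letters.\<close>

lemma form_word_eq: "form_word a w = 2 * (if a = X then 1 else - 1) * balance w"
proof (induction w)
  case (Cons b w)
  then show ?case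
    by (cases a; cases b) simp_all
qed simp

text \<open>Twice the sum over pairs is the square of the sum minus the sum of squares, and each
  sign squares to 1.\<close>

lemma pair_form_eq:
  "pair_form p v = (balance p + balance v)\<^sup>2 - (balance p)\<^sup>2 - int (length v)"
  by (induction v arbitrary: p) (auto simp: form_word_eq power2_eq_square algebra_simps)

lemma U_palindrome:
  fixes q :: "'a::field"
  assumes "q \<noteq> 0" "\<forall>k::nat. k > 0 \<longrightarrow> q ^ k \<noteq> 1"
    and "rev w = w" "even (length w)" "balance w = 0"
    and suffixes: "\<And>s t. w = s @ t \<Longrightarrow> s \<noteq> [] \<Longrightarrow> word t \<in> U q"
  shows "word w \<in> U q"
proof (cases w)
  case (Cons b v)
  have "word (rev s @ b # []) \<in> U q \<and> word t \<in> U q" if "v = s @ t" "t \<noteq> []" for s t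
  proof
    \<comment> \<open>In a palindrome a reversed proper prefix is a proper suffix, so
      \<open>suffixes\<close> covers both factors.\<close>
    have "w = rev t @ rev s @ [b]"
      using assms(3) that Cons by (metis append.assoc append_Cons rev.simps(2) rev_append)
    then show "word (rev s @ b # []) \<in> U q"
      using suffixes that(2) by simp
    show "word t \<in> U q"
      using suffixes[of "b # s" t] that Cons by simp
  qed
  from U_reverse_step[OF assms(1) this]
  have "word w - smult ((- 1) ^ length v * q powi pair_form [b] v) (word (rev w)) \<in> U q"
    by (simp add: Cons word_mult)
  moreover have "pair_form [b] v = - int (length w)"
    using assms(5) by (auto simp: pair_form_eq Cons)
  moreover have "odd (length v)"
    using assms(4) Cons by simp
  \<comment> \<open>The sign is -1, so the two copies of \<open>word w\<close> add up.\<close>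
  ultimately have "smult (1 + q powi (- int (length w))) (word w) \<in> U q"
    by (simp add: assms(3) free_alg.scale_left_distrib)
  moreover have "1 + q powi (- int (length w)) \<noteq> 0"
  proof
    assume "1 + q powi (- int (length w)) = 0"
    then have "q ^ length w = - 1"
      using assms(1) by (simp add: power_int_minus field_simps eq_neg_iff_add_eq_0)
    then have "q ^ (length w * 2) = 1"
      by (simp add: power_mult)
    then show False
      using assms(2) Cons by (metis length_greater_0_conv list.discI nat_0_less_mult_iff zero_less_numeral)
  qed
  ultimately show ?thesis
    by (simp add: U_smult_iff)
qed (simp add: U_word_Nil)

section \<open>Doubly alternating words lie in \<open>U\<close>\<close>

lemma proper_suffix_of_power:
  assumes "concat (replicate n [a, b, b, a]) = s @ t" "s \<noteq> []"
  obtains m where "m < n"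
    "t \<in> {concat (replicate m [a, b, b, a]), a # concat (replicate m [a, b, b, a]),
      b # a # concat (replicate m [a, b, b, a]), b # b # a # concat (replicate m [a, b, b, a])}"
proof -
  have "\<exists>m<n. t \<in> {concat (replicate m [a, b, b, a]), a # concat (replicate m [a, b, b, a]),
      b # a # concat (replicate m [a, b, b, a]), b # b # a # concat (replicate m [a, b, b, a])}"
    using assms
  proof (induction n arbitrary: s)
    case (Suc n)
    show ?case
    \<comment> \<open>Either a whole period splits off \<open>s\<close>, or \<open>s\<close> ends
      within or at the end of the first period.\<close>
    proof (cases "\<exists>s'. s' \<noteq> [] \<and> s = a # b # b # a # s'")
      case True
      then obtain s' where "s' \<noteq> []" "concat (replicate n [a, b, b, a]) = s' @ t"
        using Suc.prems by auto
      from Suc.IH[OF this(2,1)] show ?thesis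
        using less_SucI by blast
    next
      case False
      then have "t \<in> {concat (replicate n [a, b, b, a]), a # concat (replicate n [a, b, b, a]),
          b # a # concat (replicate n [a, b, b, a]), b # b # a # concat (replicate n [a, b, b, a])}"
        using Suc.prems by (auto simp: Cons_eq_append_conv)
      then show ?thesis
        by blast
    qed
  qed simp
  then show ?thesis
    using that by blast
qed

lemma rev_concat_replicate: "rev (concat (replicate n w)) = concat (replicate n (rev w))"
  by (simp add: rev_concat rev_map[symmetric])

text \<open>The palindrome of order \<open>n\<close> has suffixes built from smaller words of both
  kinds; it then yields the block word through their difference. Both letter orders occur, so
  \<open>c\<close> and \<open>d\<close> vary.\<close>

lemma U_doubly_alternating:
  fixes q :: "'a::field"
  assumes q: "q \<noteq> 0" "\<forall>k::nat. k > 0 \<longrightarrow> q ^ k \<noteq> 1" and "c \<noteq> d"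
  shows "word (blocks c d n) \<in> U q \<and> word (concat (replicate n [c, d, d, c])) \<in> U q"
  using assms(3)
proof (induction n arbitrary: c d rule: less_induct)
  case (less n)
  have q4: "q ^ 4 \<noteq> 1"
    using q(2) by simp
  show ?case
  proof (cases n)
    case (Suc n')
    have pal: "word (concat (replicate n [c, d, d, c])) \<in> U q"
    proof (rule U_palindrome[OF q])
      show "word t \<in> U q" if split: "concat (replicate n [c, d, d, c]) = s @ t" "s \<noteq> []" for s t
      proof -
        from proper_suffix_of_power[OF split] obtain m where m: "m < n"
          and t: "t \<in> {concat (replicate m [c, d, d, c]), c # concat (replicate m [c, d, d, c]),
            d # c # concat (replicate m [c, d, d, c]),
            d # d # c # concat (replicate m [c, d, d, c])}" .
        \<comment> \<open>Apart from the smaller palindrome, the suffixes are regrouped words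
          reached from \<open>blocks c d m\<close>.\<close>
        have rot1: "blocks c d m @ [c] = c # concat (replicate m [c, d, d, c])"
          using concat_replicate_rotate[of m "[c]" "[c, d, d]"] by simp
        have rot2: "blocks d c m @ [d, d, c] = d # d # c # concat (replicate m [c, d, d, c])"
          using arg_cong[OF concat_replicate_rotate[of m "[d, d]" "[c, c]"], of "\<lambda>w. w @ [c]"] rot1
          by simp
        have IH: "word (blocks c d m) \<in> U q" "word (concat (replicate m [c, d, d, c])) \<in> U q"
          using less.IH[OF m less.prems] by auto
        have 1: "word (blocks c d m @ [c]) \<in> U q"
          using U_blocks_snoc[OF q(1) q4 less.prems IH(1)] .
        have 2: "word (d # blocks c d m @ [c]) \<in> U q"
          using U_Cons_blocks_snoc[OF q(1) q4 less.prems[symmetric] 1] .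
        have 3: "word (blocks d c m @ [d, d, c]) \<in> U q"
          using U_blocks_append3[OF q(1) q4 less.prems[symmetric] 2] .
        show ?thesis
          using t IH 1 2 3 by (auto simp: rot1 rot2)
      qed
      show "balance (concat (replicate n [c, d, d, c])) = 0"
        using less.prems by (induction n) (cases c; cases d; simp)+
      show "even (length (concat (replicate n [c, d, d, c])))"
        by (simp add: length_concat sum_list_replicate)
    qed (simp add: rev_concat_replicate)
    have n': "n' < n"
      using Suc by simp
    \<comment> \<open>Starting with swapped letters makes the final difference contain
      \<open>blocks c d n\<close>.\<close>
    have 0: "word (blocks d c n') \<in> U q"
      using less.IH[OF n'] less.prems by auto
    have 1: "word (blocks d c n' @ [d]) \<in> U q"
      using U_blocks_snoc[OF q(1) q4 less.prems[symmetric] 0] .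
    have 2: "word (c # blocks d c n' @ [d]) \<in> U q"
      using U_Cons_blocks_snoc[OF q(1) q4 less.prems 1] .
    have 3: "word (c # d # d # blocks c d n') \<in> U q"
      using U_Cons3_blocks[OF q(1) q4 less.prems[symmetric] 2] .
    have "word (blocks c d n) \<in> U q"
      using U_add[OF U_blocks_diff_palindrome[OF q(1) q4 less.prems 3]] pal Suc by force
    then show ?thesis
      using pal ..
  qed (simp add: U_word_Nil)
qed

section \<open>The four relations\<close>

theorem proposition4p8:
  fixes q :: "'a::field_char_0" and n :: nat
  assumes "q \<noteq> 0" and "\<forall>k::nat. k > 0 \<longrightarrow> q ^ k \<noteq> 1"
  shows
    "{\<^bold>x * (\<^bold>y * \<^bold>y * \<^bold>x * \<^bold>x) ^ n * \<^bold>y,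
      \<^bold>x * \<^bold>y * \<^bold>y * (\<^bold>x * \<^bold>x * \<^bold>y * \<^bold>y) ^ n,
      \<^bold>y * (\<^bold>x * \<^bold>x * \<^bold>y * \<^bold>y) ^ n * \<^bold>x,
      (\<^bold>y * \<^bold>y * \<^bold>x * \<^bold>x) ^ n * \<^bold>y * \<^bold>y * \<^bold>x,
      \<^bold>x * \<^bold>y * \<^bold>y * (\<^bold>x * \<^bold>x * \<^bold>y * \<^bold>y) ^ n * \<^bold>x,
      \<^bold>y * \<^bold>x * \<^bold>x * (\<^bold>y * \<^bold>y * \<^bold>x * \<^bold>x) ^ n * \<^bold>y,
      \<^bold>y * (\<^bold>x * \<^bold>x * \<^bold>y * \<^bold>y) ^ (n + 1),
      (\<^bold>y * \<^bold>y * \<^bold>x * \<^bold>x) ^ (n + 1) * \<^bold>y,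
      \<^bold>y} \<subseteq> U q \<and>
      qcomm q (\<^bold>x * (\<^bold>y * \<^bold>y * \<^bold>x * \<^bold>x) ^ n * \<^bold>y) \<^bold>y =
      smult (q powi 2 - q powi (-2)) (\<^bold>x * \<^bold>y * \<^bold>y * (\<^bold>x * \<^bold>x * \<^bold>y * \<^bold>y) ^ n) \<and>
      qcomm q \<^bold>y (\<^bold>y * (\<^bold>x * \<^bold>x * \<^bold>y * \<^bold>y) ^ n * \<^bold>x) =
      smult (q powi 2 - q powi (-2)) ((\<^bold>y * \<^bold>y * \<^bold>x * \<^bold>x) ^ n * \<^bold>y * \<^bold>y * \<^bold>x) \<and>
      qcomm q (\<^bold>x * \<^bold>y * \<^bold>y * (\<^bold>x * \<^bold>x * \<^bold>y * \<^bold>y) ^ n * \<^bold>x) \<^bold>y = 0 \<and>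
      qcomm q (\<^bold>y * \<^bold>x * \<^bold>x * (\<^bold>y * \<^bold>y * \<^bold>x * \<^bold>x) ^ n * \<^bold>y) \<^bold>y =
      smult (q powi 2 - q powi (-2))
        (\<^bold>y * (\<^bold>x * \<^bold>x * \<^bold>y * \<^bold>y) ^ (n + 1) - (\<^bold>y * \<^bold>y * \<^bold>x * \<^bold>x) ^ (n + 1) * \<^bold>y)"
proof -
  have q4: "q ^ 4 \<noteq> 1"
    using assms(2) by simp
  have A: "word (blocks a b k) \<in> U q"
      and P: "word (concat (replicate k [a, b, b, a])) \<in> U q" if "a \<noteq> b" for a b k
    using U_doubly_alternating[OF assms that] by auto
  have B: "word (a # blocks b a k @ [b]) \<in> U q" if "a \<noteq> b" for a b k
    using U_Cons_blocks_snoc[OF assms(1) q4 that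
        U_blocks_snoc[OF assms(1) q4 that[symmetric] A[OF that[symmetric]]]] .
  \<comment> \<open>The word is the palindrome \<open>(abba)^(n+1)\<close>.\<close>
  have C: "word (a # b # b # blocks a b n @ [a]) \<in> U q" if "a \<noteq> b" for a b
    using P[OF that, of "Suc n"] concat_replicate_rotate[of n "[a]" "[a, b, b]"] by simp
  have "word (X # blocks Y X n @ [Y]) \<in> U q" "word (Y # blocks X Y n @ [X]) \<in> U q"
    by (simp_all add: B)
  moreover have "word (X # Y # Y # blocks X Y n) \<in> U q"
    using U_Cons3_blocks[OF assms(1) q4 _ B, of Y X n] by simp
  moreover have "word (blocks Y X n @ [Y, Y, X]) \<in> U q"
    using U_blocks_append3[OF assms(1) q4 _ B, of Y X n] by simp
  moreover have "word (X # Y # Y # blocks X Y n @ [X]) \<in> U q"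
      "word (Y # X # X # blocks Y X n @ [Y]) \<in> U q"
    by (simp_all add: C)
  moreover have "word (Y # blocks X Y (n + 1)) \<in> U q"
    by (rule U_Cons_blocks[OF assms(1) q4]) (simp_all only: A letter.distinct not_False_eq_True)
  moreover have "word (blocks Y X (n + 1) @ [Y]) \<in> U q"
    by (rule U_blocks_snoc[OF assms(1) q4]) (simp_all only: A letter.distinct not_False_eq_True)
  moreover have "word [Y] \<in> U q"
    by (rule U_letter)
  moreover note qcomm_Cons_blocks_snoc_right[of q Y X n, OF assms(1)] qcomm_Cons_blocks_snoc_left[of q Y X n, OF assms(1)]
    qcomm_palindrome_outer_other[of q Y X n, OF assms(1)] qcomm_palindrome_outer_same[of q Y X n, OF assms(1)]
  ultimately show ?thesis
    by (simp only: word_mult word_power append.simps append_assoc insert_subset empty_subsetI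
        Suc_eq_plus1 letter.distinct not_False_eq_True simp_thms)
qed

end
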